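(* Let $n\ge 2$, $p\ge 1$ and let $f\colon M^{2n}\to\mathbb{R}^{2n+p}$ be a real Kaehler submanifold (with substantial codimension $p$). Assume that the complex $s$-nullities of $f$ satisfy $\nu^c_s(x)<2(n-s)$ at every $x\in M^{2n}$ for all $1\leq s\leq p$. Then $f$ is a minimal immersion.
   Context: A real Kaehler submanifold $f\colon M^{2n}\to\mathbb{R}^{2n+p}$ is an isometric immersion into Euclidean space of a connected Kaehler manifold $(M^{2n},J)$ of complex dimension $n\geq 2$ (real dimension $2n$, complex structure $J$), with substantial codimension $p$; the latter means that the codimension cannot be reduced, even locally (i.e. no nonempty open subset of $M^{2n}$ is mapped by $f$ into an affine subspace of dimension less than $2n+p$). Let $\alpha\colon TM\times TM\to N_fM$ denote the second fundamental form of $f$, with values in the normal bundle $N_fM$. For $x\in M$, $1\le s\le p$ and an $s$-dimensional subspace $U^s\subset N_fM(x)$, let $\pi_{U^s}\colon N_fM(x)\to U^s$ be the orthogonal projection, $\alpha_{U^s}=\pi_{U^s}\circ\alpha$, and $$\mathcal{N}(\alpha_{U^s})=\{X\in T_xM : \alpha_{U^s}(X,Y)=0 \text{ for all } Y\in T_xM\}.$$ The complex $s$-nullity of $f$ at $x$ is $$\nu^c_s(x)=\max_{U^s\subset N_fM(x)}\dim\big(\mathcal{N}(\alpha_{U^s})\cap J\mathcal{N}(\alpha_{U^s})\big),$$ where the maximum is over all $s$-dimensional subspaces $U^s$ of $N_fM(x)$ and dimensions are real. An isometric immersion is minimal if the trace of its second fundamental form vanishes identically. *)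

theory Defs
  imports "HOL-Analysis.Analysis"
begin

section \<open>Smooth maps on open subsets of Euclidean spaces\<close>

primrec Ck_on :: "nat \<Rightarrow> ('e::euclidean_space \<Rightarrow> 'b::euclidean_space) \<Rightarrow> 'e set \<Rightarrow> bool" where
  "Ck_on 0 F S \<longleftrightarrow> continuous_on S F"
| "Ck_on (Suc k) F S \<longleftrightarrow>
     (\<forall>q\<in>S. F differentiable (at q)) \<and>
     (\<forall>v. Ck_on k (\<lambda>q. frechet_derivative F (at q) v) S)"

definition smooth_on :: "'e set \<Rightarrow> ('e::euclidean_space \<Rightarrow> 'b::euclidean_space) \<Rightarrow> bool" where
  "smooth_on S F \<longleftrightarrow> (\<forall>k. Ck_on k F S)"

section \<open>Smooth manifolds\<close>

text \<open>
  The underlying space of a manifold is a whole type \<open>'a\<close> of sort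
  \<open>{t2_space, second_countable_topology}\<close>, the model space is a Euclidean space \<open>'e\<close>.
  The values of \<open>chart_map c\<close> outside \<open>chart_dom c\<close> are irrelevant.
\<close>

datatype ('a, 'e) chart = Chart (chart_dom: "'a set") (chart_map: "'a \<Rightarrow> 'e")

definition chart_image :: "('a, 'e) chart \<Rightarrow> 'e set" where
  "chart_image c = chart_map c ` chart_dom c"

definition chart_inv :: "('a, 'e) chart \<Rightarrow> 'e \<Rightarrow> 'a" where
  "chart_inv c = inv_into (chart_dom c) (chart_map c)"

definition is_chart :: "('a::topological_space, 'e::euclidean_space) chart \<Rightarrow> bool" where
  "is_chart c \<longleftrightarrow> open (chart_dom c) \<and> open (chart_image c) \<and>
     homeomorphism (chart_dom c) (chart_image c) (chart_map c) (chart_inv c)"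

definition overlap :: "('a, 'e) chart \<Rightarrow> ('a, 'e) chart \<Rightarrow> 'e set" where
  "overlap c d = chart_map c ` (chart_dom c \<inter> chart_dom d)"

definition transition :: "('a, 'e) chart \<Rightarrow> ('a, 'e) chart \<Rightarrow> 'e \<Rightarrow> 'e" where
  "transition c d = chart_map d \<circ> chart_inv c"

definition smooth_atlas ::
  "('a::{t2_space, second_countable_topology}, 'e::euclidean_space) chart set \<Rightarrow> bool" where
  "smooth_atlas A \<longleftrightarrow>
     (\<forall>c\<in>A. is_chart c) \<and>
     (\<Union>c\<in>A. chart_dom c) = UNIV \<and>
     (\<forall>c\<in>A. \<forall>d\<in>A. smooth_on (overlap c d) (transition c d))"

section \<open>Riemannian metrics and Kaehler structures\<close>

text \<open>
  Tensor fields are given by their local representatives: a chart \<open>c\<close> around \<open>x\<close> identifies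
  the tangent space at \<open>x\<close> with the model space \<open>'e\<close>, and \<open>g c q\<close>, \<open>J c q\<close> are the expressions of
  the tensors at the point with coordinates \<open>q \<in> chart_image c\<close>. Representatives in different
  charts are related by the differential of the transition map.
\<close>

type_synonym 'e local_metric = "'e \<Rightarrow> 'e \<Rightarrow> 'e \<Rightarrow> real"
type_synonym 'e local_endo = "'e \<Rightarrow> 'e \<Rightarrow> 'e"

definition riemannian_metric ::
  "('a::topological_space, 'e::euclidean_space) chart set \<Rightarrow>
   (('a, 'e) chart \<Rightarrow> 'e local_metric) \<Rightarrow> bool" where
  "riemannian_metric A g \<longleftrightarrow>
     (\<forall>c\<in>A. (\<forall>u v. smooth_on (chart_image c) (\<lambda>q. g c q u v)) \<and>
        (\<forall>q\<in>chart_image c. bilinear (g c q) \<and>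
           (\<forall>u v. g c q u v = g c q v u) \<and> (\<forall>u. u \<noteq> 0 \<longrightarrow> g c q u u > 0))) \<and>
     (\<forall>c\<in>A. \<forall>d\<in>A. \<forall>q\<in>overlap c d. \<forall>u v.
        g c q u v = g d (transition c d q)
          (frechet_derivative (transition c d) (at q) u)
          (frechet_derivative (transition c d) (at q) v))"

definition almost_complex_structure ::
  "('a::topological_space, 'e::euclidean_space) chart set \<Rightarrow>
   (('a, 'e) chart \<Rightarrow> 'e local_endo) \<Rightarrow> bool" where
  "almost_complex_structure A J \<longleftrightarrow>
     (\<forall>c\<in>A. (\<forall>u. smooth_on (chart_image c) (\<lambda>q. J c q u)) \<and>
        (\<forall>q\<in>chart_image c. linear (J c q) \<and> (\<forall>u. J c q (J c q u) = - u))) \<and>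
     (\<forall>c\<in>A. \<forall>d\<in>A. \<forall>q\<in>overlap c d. \<forall>u.
        frechet_derivative (transition c d) (at q) (J c q u) =
        J d (transition c d q) (frechet_derivative (transition c d) (at q) u))"

text \<open>
  The Levi-Civita connection in coordinates. The vector \<open>christoffel G q u v\<close> is the covariant
  derivative along \<open>u\<close> of the constant coordinate field \<open>v\<close>, given by the Koszul formula
  (the Lie brackets of constant coordinate fields vanish).
\<close>

definition christoffel :: "('e::euclidean_space) local_metric \<Rightarrow> 'e \<Rightarrow> 'e \<Rightarrow> 'e \<Rightarrow> 'e" where
  "christoffel G q u v = (THE z. \<forall>w. 2 * G q z w =
       frechet_derivative (\<lambda>r. G r v w) (at q) u
     + frechet_derivative (\<lambda>r. G r u w) (at q) v
     - frechet_derivative (\<lambda>r. G r u v) (at q) w)"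

definition cov_deriv ::
  "('e::euclidean_space) local_metric \<Rightarrow> 'e \<Rightarrow> 'e \<Rightarrow> ('e \<Rightarrow> 'e) \<Rightarrow> 'e" where
  "cov_deriv G q u Y = frechet_derivative Y (at q) u + christoffel G q u (Y q)"

definition kaehler_structure ::
  "('a::topological_space, 'e::euclidean_space) chart set \<Rightarrow>
   (('a, 'e) chart \<Rightarrow> 'e local_metric) \<Rightarrow> (('a, 'e) chart \<Rightarrow> 'e local_endo) \<Rightarrow> bool" where
  "kaehler_structure A g J \<longleftrightarrow>
     riemannian_metric A g \<and> almost_complex_structure A J \<and>
     (\<forall>c\<in>A. \<forall>q\<in>chart_image c. \<forall>u v. g c q (J c q u) (J c q v) = g c q u v) \<and>
     (\<forall>c\<in>A. \<forall>Y. smooth_on (chart_image c) Y \<longrightarrow> (\<forall>q\<in>chart_image c. \<forall>u.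
        cov_deriv (g c) q u (\<lambda>r. J c r (Y r)) = J c q (cov_deriv (g c) q u Y)))"

definition kaehler_manifold ::
  "('a::{t2_space, second_countable_topology}, 'e::euclidean_space) chart set \<Rightarrow>
   (('a, 'e) chart \<Rightarrow> 'e local_metric) \<Rightarrow> (('a, 'e) chart \<Rightarrow> 'e local_endo) \<Rightarrow> bool" where
  "kaehler_manifold A g J \<longleftrightarrow> smooth_atlas A \<and> kaehler_structure A g J"

section \<open>Isometric immersions and the second fundamental form\<close>

definition in_chart :: "('a \<Rightarrow> 'b) \<Rightarrow> ('a, 'e) chart \<Rightarrow> 'e \<Rightarrow> 'b" where
  "in_chart f c = f \<circ> chart_inv c"

definition differential ::
  "('a \<Rightarrow> 'b::euclidean_space) \<Rightarrow> ('a, 'e::euclidean_space) chart \<Rightarrow> 'a \<Rightarrow> 'e \<Rightarrow> 'b" where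
  "differential f c x = frechet_derivative (in_chart f c) (at (chart_map c x))"

definition isometric_immersion ::
  "('a::topological_space, 'e::euclidean_space) chart set \<Rightarrow>
   (('a, 'e) chart \<Rightarrow> 'e local_metric) \<Rightarrow> ('a \<Rightarrow> 'b::euclidean_space) \<Rightarrow> bool" where
  "isometric_immersion A g f \<longleftrightarrow>
     (\<forall>c\<in>A. smooth_on (chart_image c) (in_chart f c) \<and>
        (\<forall>x\<in>chart_dom c. inj (differential f c x) \<and>
           (\<forall>u v. differential f c x u \<bullet> differential f c x v = g c (chart_map c x) u v)))"

definition substantial :: "('a::topological_space \<Rightarrow> 'b::euclidean_space) \<Rightarrow> bool" where
  "substantial f \<longleftrightarrow>
     \<not> (\<exists>V S. open V \<and> V \<noteq> {} \<and> affine S \<and> aff_dim S < int DIM('b) \<and> f ` V \<subseteq> S)"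

definition orth_proj :: "'b::euclidean_space set \<Rightarrow> 'b \<Rightarrow> 'b" where
  "orth_proj U y = (THE z. z \<in> U \<and> (\<forall>w\<in>U. (y - z) \<bullet> w = 0))"

definition normal_space ::
  "('a \<Rightarrow> 'b::euclidean_space) \<Rightarrow> ('a, 'e::euclidean_space) chart \<Rightarrow> 'a \<Rightarrow> 'b set" where
  "normal_space f c x = orthogonal_comp (range (differential f c x))"

text \<open>
  The second fundamental form is the normal component of the Euclidean derivative, along \<open>u\<close>,
  of the vector field \<open>df(Y)\<close>. Since it is tensorial, \<open>Y\<close> may be taken to be the
  constant coordinate field \<open>v\<close>.
\<close>

definition second_fundamental_form ::
  "('a \<Rightarrow> 'b::euclidean_space) \<Rightarrow> ('a, 'e::euclidean_space) chart \<Rightarrow> 'a \<Rightarrow> 'e \<Rightarrow> 'e \<Rightarrow> 'b" where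
  "second_fundamental_form f c x u v =
     orth_proj (normal_space f c x)
       (frechet_derivative (\<lambda>q. frechet_derivative (in_chart f c) (at q) v) (at (chart_map c x)) u)"

section \<open>Complex nullities and minimality\<close>

definition nullity_space ::
  "('a \<Rightarrow> 'b::euclidean_space) \<Rightarrow> ('a, 'e::euclidean_space) chart \<Rightarrow> 'a \<Rightarrow> 'b set \<Rightarrow> 'e set" where
  "nullity_space f c x U = {u. \<forall>v. orth_proj U (second_fundamental_form f c x u v) = 0}"

text \<open>
  The value does not depend on the chart \<open>c\<close> around \<open>x\<close>. For \<open>1 \<le> s \<le> p\<close>, with \<open>p\<close> the
  codimension, the maximum is over a nonempty finite set of numbers.
\<close>

definition complex_nullity ::
  "(('a, 'e::euclidean_space) chart \<Rightarrow> 'e local_endo) \<Rightarrow> ('a \<Rightarrow> 'b::euclidean_space) \<Rightarrow>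
   nat \<Rightarrow> ('a, 'e) chart \<Rightarrow> 'a \<Rightarrow> nat" where
  "complex_nullity J f s c x =
     Max {dim (nullity_space f c x U \<inter> J c (chart_map c x) ` nullity_space f c x U) | U.
            subspace U \<and> U \<subseteq> normal_space f c x \<and> dim U = s}"

definition orthonormal_basis :: "('e::euclidean_space \<Rightarrow> 'e \<Rightarrow> real) \<Rightarrow> 'e set \<Rightarrow> bool" where
  "orthonormal_basis G B \<longleftrightarrow>
     span B = UNIV \<and> (\<forall>b\<in>B. \<forall>b'\<in>B. G b b' = (if b = b' then 1 else 0))"

definition minimal_immersion ::
  "('a::topological_space, 'e::euclidean_space) chart set \<Rightarrow>
   (('a, 'e) chart \<Rightarrow> 'e local_metric) \<Rightarrow> ('a \<Rightarrow> 'b::euclidean_space) \<Rightarrow> bool" where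
  "minimal_immersion A g f \<longleftrightarrow>
     isometric_immersion A g f \<and>
     (\<forall>c\<in>A. \<forall>x\<in>chart_dom c. \<forall>B. orthonormal_basis (g c (chart_map c x)) B \<longrightarrow>
        (\<Sum>b\<in>B. second_fundamental_form f c x b b) = 0)"

end

theory Submission
  imports Defs
begin

text \<open>
  The argument is pointwise. The Gauss equation and the Kaehler symmetry of the curvature say that
  \<open>\<langle>\<alpha>(x,w), \<alpha>(z,y)\<rangle> - \<langle>\<alpha>(x,Jw), \<alpha>(z,Jy)\<rangle>\<close> is symmetric in \<open>w\<close> and \<open>y\<close>. Put
  \<open>P(x,y) = \<alpha>(x,y) + \<alpha>(Jx,Jy)\<close>; the trace of \<open>P\<close> is twice that of \<open>\<alpha>\<close>, so it suffices to show \<open>P = 0\<close>.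
  The form \<open>P\<close> is the real part of a vector-valued Hermitian form, which inherits the symmetry, so that
  \<open>\<langle>P(x,x), P(w,w)\<rangle> = |P(x,w)|\<^sup>2 + |P(x,Jw)|\<^sup>2\<close>. Hence the null space of \<open>P\<close> is the common kernel
  of \<open>P(x,_)\<close> and \<open>P(x,J_)\<close> for a suitable single \<open>x\<close>; if \<open>U\<close> is the span of the values of \<open>P\<close> and
  \<open>s = dim U\<close>, its dimension is at least \<open>2n - 2s\<close>. The symmetry also makes \<open>\<alpha>(y,_)\<close> orthogonal to \<open>U\<close>
  for \<open>y\<close> in the null space, so \<open>\<nu>\<^sup>c\<^sub>s \<ge> 2(n - s)\<close> unless \<open>U = 0\<close>.
\<close>

section \<open>Pluriharmonicity from flatness\<close>

text \<open>Rank-nullity as an inequality: \<open>L\<close> embeds the orthogonal complement of its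
  kernel into \<open>S\<close>.\<close>

lemma dim_kernel_ge:
  fixes L :: "'a::euclidean_space \<Rightarrow> 'b::euclidean_space"
  assumes "linear L" and "range L \<subseteq> S"
  shows "DIM('a) \<le> dim {y. L y = 0} + dim S"
proof -
  let ?K = "{y. L y = 0}"
  let ?C = "{y \<in> UNIV. \<forall>x\<in>?K. orthogonal x y}"
  have K: "subspace ?K"
    using assms(1) by (rule linear_subspace_kernel)
  have C: "subspace ?C"
    using subspace_orthogonal_to_vectors[of ?K] by simp
  have "inj_on L ?C"
  proof (rule inj_onI)
    fix y z assume yz: "y \<in> ?C" "z \<in> ?C" "L y = L z"
    then have "L (y - z) = 0"
      using assms(1) by (simp add: linear_diff)
    moreover have "y - z \<in> ?C"
      using C yz(1,2) by (rule subspace_diff)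
    ultimately have "orthogonal (y - z) (y - z)" by blast
    then show "y = z" by (simp add: orthogonal_self)
  qed
  then have "dim (L ` ?C) = dim ?C"
    using dim_image_eq[OF assms(1), of ?C] C by (simp only: span_eq_iff[THEN iffD2])
  moreover have "dim (L ` ?C) \<le> dim S"
    by (rule dim_subset) (use assms(2) in auto)
  moreover have "dim ?C + dim ?K = DIM('a)"
    using dim_subspace_orthogonal_to_vectors[OF K subspace_UNIV] by simp
  ultimately show ?thesis by linarith
qed

text \<open>This resolves the \<open>THE\<close> in \<open>orth_proj\<close>: the difference of two
  candidates lies in \<open>U\<close> and is orthogonal to \<open>U\<close>, hence to
  itself.\<close>

lemma orth_proj_unique:
  assumes "subspace U" "z \<in> U" "\<And>w. w \<in> U \<Longrightarrow> (y - z) \<bullet> w = 0"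
  shows "orth_proj U y = z"
  unfolding orth_proj_def
proof (rule the_equality)
  show "z \<in> U \<and> (\<forall>w\<in>U. (y - z) \<bullet> w = 0)" using assms by blast
  fix z' assume z': "z' \<in> U \<and> (\<forall>w\<in>U. (y - z') \<bullet> w = 0)"
  then have "z' - z \<in> U" using assms(1,2) subspace_diff by blast
  then have "(y - z) \<bullet> (z' - z) - (y - z') \<bullet> (z' - z) = 0"
    using assms(3) z' by simp
  then have "(z' - z) \<bullet> (z' - z) = 0"
    by (simp add: inner_diff_left)
  then show "z' = z" by simp
qed

lemma
  assumes "subspace U"
  shows orth_proj_in: "orth_proj U y \<in> U"
    and orth_proj_orthogonal: "w \<in> U \<Longrightarrow> (y - orth_proj U y) \<bullet> w = 0"
proof -
  obtain a b where ab: "a \<in> span U" "\<And>w. w \<in> span U \<Longrightarrow> orthogonal b w" "y = a + b"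
    using orthogonal_subspace_decomp_exists[of U y] by metis
  have U: "span U = U" using assms span_eq_iff by blast
  have "orth_proj U y = a"
    using ab unfolding U by (intro orth_proj_unique assms) (auto simp: orthogonal_def)
  then show "orth_proj U y \<in> U" "w \<in> U \<Longrightarrow> (y - orth_proj U y) \<bullet> w = 0"
    using ab unfolding U by (auto simp: orthogonal_def)
qed

lemma linear_orth_proj:
  assumes "subspace U"
  shows "linear (orth_proj U)"
proof (rule linearI)
  fix x y and r :: real
  show "orth_proj U (x + y) = orth_proj U x + orth_proj U y"
    using orth_proj_orthogonal[OF assms, of _ x] orth_proj_orthogonal[OF assms, of _ y]
    by (intro orth_proj_unique assms subspace_add orth_proj_in)
       (simp add: algebra_simps)
  show "orth_proj U (r *\<^sub>R x) = r *\<^sub>R orth_proj U x"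
    using orth_proj_orthogonal[OF assms, of _ x]
    by (intro orth_proj_unique assms subspace_scale orth_proj_in)
       (simp add: algebra_simps)
qed

lemma orth_proj_eq_0:
  assumes "subspace U" "\<And>w. w \<in> U \<Longrightarrow> y \<bullet> w = 0"
  shows "orth_proj U y = 0"
  by (rule orth_proj_unique) (use assms subspace_0 in auto)

lemma add_self_eq_0_iff:
  fixes x :: "'a::real_vector"
  shows "x + x = 0 \<longleftrightarrow> x = 0"
  by (metis scaleR_2 scaleR_eq_0_iff zero_neq_numeral)

section \<open>Algebra of the second fundamental form at one point\<close>

text \<open>The curvature is already eliminated: \<open>flat\<close> equates the Gauss expressions
  of \<langle>R(x,z)y, w\<rangle> and \<langle>R(x,z)Jy, Jw\<rangle>, with the terms regrouped. A
  metric on the tangent space enters only in \<open>trace_zero\<close>.\<close>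

locale kaehler_flat_form =
  fixes \<alpha> :: "'e::euclidean_space \<Rightarrow> 'e \<Rightarrow> 'b::euclidean_space"
    and J :: "'e \<Rightarrow> 'e"
  assumes bilinear: "bilinear \<alpha>"
    and sym: "\<alpha> x y = \<alpha> y x"
    and linear_J: "linear J"
    and J_J: "J (J x) = - x"
    and flat: "\<alpha> x w \<bullet> \<alpha> z y - \<alpha> x (J w) \<bullet> \<alpha> z (J y)
      = \<alpha> x y \<bullet> \<alpha> z w - \<alpha> x (J y) \<bullet> \<alpha> z (J w)"
begin

definition P :: "'e \<Rightarrow> 'e \<Rightarrow> 'b" where
  "P x y = \<alpha> x y + \<alpha> (J x) (J y)"

text \<open>Requiring both equations makes \<open>ker x\<close> the kernel, in the second slot, of
  the Hermitian form with real part \<open>P\<close>.\<close>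

definition ker :: "'e \<Rightarrow> 'e set" where
  "ker x = {y. P x y = 0 \<and> P x (J y) = 0}"

definition null :: "'e set" where
  "null = {y. \<forall>x. P x y = 0}"

lemmas \<alpha>_simps = bilinear_ladd[OF bilinear] bilinear_radd[OF bilinear]
  bilinear_lneg[OF bilinear] bilinear_rneg[OF bilinear]
  bilinear_lmul[OF bilinear] bilinear_rmul[OF bilinear]

lemmas J_simps = J_J linear_add[OF linear_J] linear_neg[OF linear_J] linear_cmul[OF linear_J]

lemma P_sym: "P x y = P y x"
  by (simp add: P_def sym)

lemma P_J_left: "P (J x) y = - P x (J y)"
  by (simp add: P_def J_simps \<alpha>_simps)

lemma P_J_right: "P x (J y) = - P (J x) y"
  by (simp add: P_J_left)

lemma linear_P: "linear (P x)"
  by (rule linearI) (simp_all add: P_def J_simps \<alpha>_simps algebra_simps)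

lemma P_add_left: "P (x + y) z = P x z + P y z"
  by (simp add: P_def J_simps \<alpha>_simps algebra_simps)

text \<open>Adding \<open>flat\<close> for \<open>x, w\<close> and for \<open>J x, J w\<close>
  completes the first factor of each product to a value of \<open>P\<close>. The same step in
  \<open>z, y\<close> completes the second factors in \<open>flat_P_P\<close>.\<close>

lemma flat_P_\<alpha>:
  "P x w \<bullet> \<alpha> z y - P x (J w) \<bullet> \<alpha> z (J y) = P x y \<bullet> \<alpha> z w - P x (J y) \<bullet> \<alpha> z (J w)"
  using flat[of x w z y] flat[of "J x" "J w" z y]
  by (simp add: P_def J_simps \<alpha>_simps algebra_simps)

lemma flat_P_P:
  "P x w \<bullet> P z y - P x (J w) \<bullet> P z (J y) = P x y \<bullet> P z w - P x (J y) \<bullet> P z (J w)"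
  using flat_P_\<alpha>[of x w z y] flat_P_\<alpha>[of x w "J z" "J y"]
  by (simp add: P_def[of z] J_simps \<alpha>_simps inner_simps linear_neg[OF linear_P])

text \<open>
  \<open>P x y - i P x (J y)\<close> is a Hermitian form; this is its flatness
  on three vectors, with the term \<open>P w (J w)\<close> vanishing by skew-symmetry.
\<close>
lemma hermitian_P: "P x y \<bullet> P w w = P x w \<bullet> P y w + P x (J w) \<bullet> P y (J w)"
proof -
  have "P w (J w) = 0"
    using P_J_left[of w w] P_sym[of "J w" w]
    by (metis add_self_eq_0_iff eq_neg_iff_add_eq_0)
  then show ?thesis
    using flat_P_P[of x y w w] P_J_left[of w y] P_sym[of w y] P_sym[of "J w" y]
    by simp
qed

text \<open>A Cauchy-Schwarz argument: \<open>hermitian_P\<close> writes the inner product of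
  \<open>P x x\<close> and \<open>P y y\<close> as a sum of two squares, one of which is that of
  \<open>P x y\<close>.\<close>

lemma null_if_isotropic:
  assumes "P y y = 0"
  shows "y \<in> null"
proof -
  have "P x y \<bullet> P x y + P x (J y) \<bullet> P x (J y) = 0" for x
    using hermitian_P[of x x y] assms by simp
  then have "P x y = 0" for x
    by (smt (verit) inner_ge_zero inner_eq_zero_iff)
  then show ?thesis by (simp add: null_def)
qed

text \<open>On \<open>ker (x + y)\<close> the forms \<open>P y\<close> and \<open>- P x\<close>
  agree, so \<open>hermitian_P\<close> equates the inner product of \<open>P x y = 0\<close> with
  \<open>P w w\<close> to minus a sum of two squares.\<close>

lemma ker_add_subset:
  assumes "y \<in> ker x"
  shows "ker (x + y) \<subseteq> ker x"
proof
  fix w assume "w \<in> ker (x + y)"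
  then have "P y w = - P x w" "P y (J w) = - P x (J w)"
    by (auto simp: ker_def P_add_left add_eq_0_iff)
  then have "P x w \<bullet> P x w + P x (J w) \<bullet> P x (J w) = 0"
    using hermitian_P[of x y w] assms by (simp add: ker_def)
  then have "P x w = 0 \<and> P x (J w) = 0"
    by (smt (verit) inner_ge_zero inner_eq_zero_iff)
  then show "w \<in> ker x" by (simp add: ker_def)
qed

lemma subspace_ker: "subspace (ker x)"
  unfolding ker_def subspace_def
  by (auto simp: J_simps linear_add[OF linear_P] linear_cmul[OF linear_P]
      linear_0[OF linear_P] linear_0[OF linear_J])

text \<open>Take \<open>x\<close> with \<open>ker x\<close> of least dimension. For \<open>y\<close>
  in \<open>ker x\<close>, minimality turns the inclusion of \<open>ker_add_subset\<close> into an
  equality, so \<open>y\<close> lies in \<open>ker (x + y)\<close>; this forces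
  \<open>P y y = 0\<close>.\<close>

lemma ker_subset_null: "\<exists>x. ker x \<subseteq> null"
proof -
  obtain x where x: "\<And>y. dim (ker x) \<le> dim (ker y)"
    using exists_least_iff[of "\<lambda>k. \<exists>x. k = dim (ker x)"] by (metis leI)
  have "y \<in> null" if y: "y \<in> ker x" for y
  proof -
    have "ker (x + y) = ker x"
      using ker_add_subset[OF y] x by (intro subspace_dim_equal subspace_ker)
    then have "P (x + y) y = 0"
      using y unfolding ker_def by blast
    then have "P y y = 0"
      using y by (simp add: P_add_left ker_def)
    then show ?thesis by (rule null_if_isotropic)
  qed
  then show ?thesis by blast
qed

text \<open>The factor 2 arises because \<open>ker x\<close> is the kernel of a single linear map
  into \<open>U \<times> U\<close>, to which rank-nullity applies.\<close>

lemma dim_null_ge: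
  assumes "subspace U" "\<And>x y. P x y \<in> U"
  shows "DIM('e) \<le> dim null + 2 * dim U"
proof -
  obtain x where x: "ker x \<subseteq> null"
    using ker_subset_null by blast
  let ?L = "\<lambda>y. (P x y, P x (J y))"
  have "linear ?L"
    by (rule linearI) (simp_all add: J_simps linear_add[OF linear_P] linear_cmul[OF linear_P])
  then have "DIM('e) \<le> dim {y. ?L y = 0} + dim (U \<times> U)"
    using assms(2) by (intro dim_kernel_ge) auto
  moreover have "{y. ?L y = 0} = ker x"
    by (auto simp: ker_def zero_prod_def)
  moreover have "dim (ker x) \<le> dim null"
    using x by (rule dim_subset)
  ultimately show ?thesis
    using dim_Times[OF assms(1) assms(1)] by simp
qed

lemma J_null: "y \<in> null \<Longrightarrow> J y \<in> null"
  by (simp add: null_def P_J_right)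

text \<open>Since \<open>y\<close> and \<open>J y\<close> both lie in \<open>null\<close>, the right
  side of \<open>flat_P_\<alpha>\<close> vanishes. Swapping \<open>x\<close> and \<open>w\<close> in
  what remains fixes \<open>P x w\<close> but changes the sign of \<open>P x (J w)\<close>, so the
  inner product equals its own negative.\<close>

lemma null_orthogonal:
  assumes "y \<in> null"
  shows "P x w \<bullet> \<alpha> y z = 0"
proof -
  have J: "P a (J y) = 0" for a
    using J_null[OF assms] by (simp add: null_def)
  have *: "P a b \<bullet> \<alpha> z y = P a (J b) \<bullet> \<alpha> z (J y)" for a b
    using flat_P_\<alpha>[of a b z y] assms J by (simp add: null_def)
  have "P x w \<bullet> \<alpha> z y = - (P x w \<bullet> \<alpha> z y)"
    using *[of x w] *[of w x] P_sym[of x w] P_J_left[of x w] P_sym[of w "J x"] by simp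
  then show ?thesis by (simp add: sym)
qed

text \<open>By \<open>null_orthogonal\<close> the projection to the span of the values of
  \<open>P\<close> vanishes; \<open>null\<close> is invariant under \<open>J\<close>, so
  \<open>y = J (- J y)\<close> also puts it into the image under \<open>J\<close>.\<close>

lemma null_subset_nullity:
  assumes "U = span (range (case_prod P))"
  shows "null \<subseteq> {u. \<forall>v. orth_proj U (\<alpha> u v) = 0} \<inter> J ` {u. \<forall>v. orth_proj U (\<alpha> u v) = 0}"
proof -
  have "orth_proj U (\<alpha> y v) = 0" if "y \<in> null" for y v
  proof (rule orth_proj_eq_0)
    fix w assume "w \<in> U"
    then have "w \<in> span (range (case_prod P))" by (simp add: assms)
    moreover have "subspace {w. \<alpha> y v \<bullet> w = 0}"
      by (rule subspace_hyperplane)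
    moreover have "range (case_prod P) \<subseteq> {w. \<alpha> y v \<bullet> w = 0}"
      using null_orthogonal[OF that] by (auto simp: inner_commute)
    ultimately show "\<alpha> y v \<bullet> w = 0"
      using span_minimal by blast
  qed (simp add: assms)
  moreover have "y \<in> J ` S" if "y \<in> null" "null \<subseteq> S" for y S
  proof
    show "y = J (- J y)" by (simp add: J_simps)
    have "- J y = J (- y)" by (simp add: J_simps)
    moreover have "- y \<in> null"
      using that(1) by (simp add: null_def linear_neg[OF linear_P])
    ultimately show "- J y \<in> S" using J_null that(2) by auto
  qed
  ultimately show ?thesis by blast
qed

text \<open>\<open>W\<close> stands for the normal space. If \<open>P\<close> were nonzero, the span
  of its values would be a \<open>U\<close> for which \<open>dim_null_ge\<close> contradicts the
  nullity bound. The bound is written as a sum to avoid truncated subtraction.\<close>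

lemma P_eq_0_if_small_nullity:
  assumes W: "subspace W" "\<And>x y. \<alpha> x y \<in> W"
    and nullity: "\<And>U. subspace U \<Longrightarrow> U \<subseteq> W \<Longrightarrow> dim U \<ge> 1 \<Longrightarrow>
      dim ({u. \<forall>v. orth_proj U (\<alpha> u v) = 0} \<inter> J ` {u. \<forall>v. orth_proj U (\<alpha> u v) = 0})
        + 2 * dim U < DIM('e)"
  shows "P x y = 0"
proof (rule ccontr)
  assume "P x y \<noteq> 0"
  define U where "U = span (range (case_prod P))"
  have PU: "P x y \<in> U" for x y
    unfolding U_def by (rule span_base) force
  have "subspace U" by (simp add: U_def)
  moreover have "U \<subseteq> W"
    unfolding U_def using W by (intro span_minimal) (auto simp: P_def subspace_add)
  moreover have "dim U \<ge> 1"
  proof -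
    have "\<not> U \<subseteq> {0}" using PU[of x y] \<open>P x y \<noteq> 0\<close> by blast
    then have "dim U \<noteq> 0" by (simp only: dim_eq_0 not_False_eq_True)
    then show ?thesis by linarith
  qed
  ultimately show False
    using nullity[of U] dim_null_ge[of U] PU dim_subset[OF null_subset_nullity[OF U_def]] by fastforce
qed

section \<open>From \<open>P = 0\<close> to vanishing trace\<close>

text \<open>\<open>J\<close> is an isometry of \<open>G\<close>, so it maps \<open>B\<close> to
  another orthonormal basis, over which \<alpha> has the same trace. Twice the trace of \<alpha> is
  therefore the trace of \<open>P\<close>.\<close>

lemma trace_zero:
  assumes P: "\<And>x y. P x y = 0"
    and G: "bilinear G" "\<And>u v. G u v = G v u" "\<And>u v. G (J u) (J v) = G u v"
    and B: "orthonormal_basis G B"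
  shows "(\<Sum>b\<in>B. \<alpha> b b) = 0"
proof (cases "finite B") \<comment> \<open>an infinite \<open>B\<close> makes the sum \<open>0\<close>\<close>
  case fin: True
  have GB: "G b b' = (if b = b' then 1 else 0)" if "b \<in> B" "b' \<in> B" for b b'
    using B that by (simp add: orthonormal_basis_def)
  have lin: "linear (\<lambda>u. G u v)" "linear (G v)" for v
    using G(1) by (simp_all add: bilinear_def)
  have expand: "u = (\<Sum>b\<in>B. G u b *\<^sub>R b)" for u
  proof -
    have "u \<in> span B" using B by (simp add: orthonormal_basis_def)
    then obtain c where c: "u = (\<Sum>b\<in>B. c b *\<^sub>R b)"
      using fin by (auto simp: span_finite)
    have "G u b = c b" if b: "b \<in> B" for b
    proof -
      have "G u b = (\<Sum>b'\<in>B. c b' * G b' b)"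
        unfolding c linear_sum[OF lin(1)] by (simp add: linear_cmul[OF lin(1)])
      also have "\<dots> = (\<Sum>b'\<in>B. if b' = b then c b' else 0)"
        using b GB by (intro sum.cong) auto
      also have "\<dots> = c b" using b fin by simp
      finally show ?thesis .
    qed
    then show ?thesis using c by simp
  qed
  have \<alpha>_lin: "linear (\<lambda>u. \<alpha> u v)" "linear (\<alpha> v)" for v
    using bilinear by (simp_all add: bilinear_def)
  have \<alpha>_expand: "\<alpha> u u = (\<Sum>b\<in>B. \<Sum>b'\<in>B. (G u b * G u b') *\<^sub>R \<alpha> b b')" for u
  proof -
    have "\<alpha> u u = (\<Sum>b\<in>B. G u b *\<^sub>R \<alpha> b u)"
      using arg_cong[OF expand[of u], of "\<lambda>w. \<alpha> w u"]
      by (simp add: linear_sum[OF \<alpha>_lin(1)] \<alpha>_simps)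
    also have "\<dots> = (\<Sum>b\<in>B. G u b *\<^sub>R (\<Sum>b'\<in>B. G u b' *\<^sub>R \<alpha> b b'))"
    proof (intro sum.cong refl arg_cong[where f = "scaleR _"])
      show "\<alpha> b u = (\<Sum>b'\<in>B. G u b' *\<^sub>R \<alpha> b b')" for b
        using arg_cong[OF expand[of u], of "\<alpha> b"]
        by (simp add: linear_sum[OF \<alpha>_lin(2)] \<alpha>_simps)
    qed
    finally show ?thesis by (simp only: scaleR_right.sum scaleR_scaleR)
  qed
  have skew: "G (J u) v = - G u (J v)" for u v
    using G(3)[of u "J v"] bilinear_rneg[OF G(1)] by (simp add: J_J)
  \<comment> \<open>The matrix of \<open>J\<close> in the basis \<open>B\<close> has orthonormal
    columns because \<open>J\<close> is an isometry; skew-symmetry of \<open>J\<close> transfers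
    this to the rows.\<close>
  have GJ: "(\<Sum>u\<in>B. G (J u) b * G (J u) b') = (if b = b' then 1 else 0)"
    if "b \<in> B" "b' \<in> B" for b b'
  proof -
    have "(if b = b' then 1 else 0) = G (J b) (J b')"
      using GB G(3) that by simp
    also have "\<dots> = G (\<Sum>u\<in>B. G (J b) u *\<^sub>R u) (J b')"
      using expand[of "J b"] by simp
    also have "\<dots> = (\<Sum>u\<in>B. G (J b) u * G u (J b'))"
      by (simp add: linear_sum[OF lin(1)] linear_cmul[OF lin(1)])
    also have "\<dots> = (\<Sum>u\<in>B. G (J u) b * G (J u) b')"
    proof (rule sum.cong)
      show "G (J b) u * G u (J b') = G (J u) b * G (J u) b'" for u
        using skew[of b u] skew[of u b'] G(2)[of b "J u"] by simp
    qed simp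
    finally show ?thesis by simp
  qed
  have "(\<Sum>u\<in>B. \<alpha> (J u) (J u)) = (\<Sum>u\<in>B. \<Sum>b\<in>B. \<Sum>b'\<in>B. (G (J u) b * G (J u) b') *\<^sub>R \<alpha> b b')"
    by (intro sum.cong refl \<alpha>_expand)
  also have "\<dots> = (\<Sum>b\<in>B. \<Sum>b'\<in>B. (\<Sum>u\<in>B. G (J u) b * G (J u) b') *\<^sub>R \<alpha> b b')"
    unfolding scaleR_sum_left
    by (rule trans[OF sum.swap]) (intro sum.cong refl sum.swap)
  also have "\<dots> = (\<Sum>b\<in>B. \<Sum>b'\<in>B. (if b = b' then \<alpha> b b' else 0))"
    by (intro sum.cong refl) (simp add: GJ)
  also have "\<dots> = (\<Sum>b\<in>B. \<alpha> b b)"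
    using fin by simp
  finally have "(\<Sum>u\<in>B. \<alpha> u u) + (\<Sum>u\<in>B. \<alpha> u u) = (\<Sum>u\<in>B. P u u)"
    by (simp add: P_def sum.distrib)
  then show ?thesis
    using P by (simp add: add_self_eq_0_iff)
qed simp

end

section \<open>Calculus of smooth maps\<close>

text \<open>On an open set, derivatives depend only on the values there. This allows replacing
  \<open>frechet_derivative\<close> by formulas valid only on \<open>S\<close>.\<close>

lemma Ck_on_cong:
  assumes "open S" "\<And>q. q \<in> S \<Longrightarrow> F q = G q" "Ck_on k F S"
  shows "Ck_on k G S"
  using assms(2,3)
proof (induction k arbitrary: F G)
  case 0
  then show ?case using continuous_on_cong[OF refl, of S F G] by simp
next
  case (Suc k)
  have D: "(F has_derivative frechet_derivative F (at q)) (at q)" if "q \<in> S" for q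
    using Suc.prems(2) that by (simp add: frechet_derivative_works[symmetric])
  have G: "(G has_derivative frechet_derivative F (at q)) (at q)" if "q \<in> S" for q
    by (rule has_derivative_transform_within_open[OF D[OF that] assms(1) that])
       (rule Suc.prems(1))
  have "Ck_on k (\<lambda>q. frechet_derivative G (at q) v) S" for v
  proof (rule Suc.IH)
    show "Ck_on k (\<lambda>q. frechet_derivative F (at q) v) S"
      using Suc.prems(2) by simp
  qed (simp flip: frechet_derivative_at[OF G])
  moreover have "\<forall>q\<in>S. G differentiable (at q)"
    using G by (auto simp: differentiable_def)
  ultimately show ?case by simp
qed

lemma Ck_on_Suc_imp:
  assumes "Ck_on (Suc k) F S"
  shows "Ck_on k F S"
  using assms
proof (induction k arbitrary: F)
  case 0
  then show ?case
    by (auto intro!: continuous_at_imp_continuous_on differentiable_imp_continuous_within)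
next
  case (Suc k)
  have "Ck_on (Suc k) (\<lambda>q. frechet_derivative F (at q) v) S" for v
    using Suc.prems unfolding Ck_on.simps(2)[of "Suc k"] by blast
  then have "Ck_on k (\<lambda>q. frechet_derivative F (at q) v) S" for v
    by (rule Suc.IH)
  then show ?case using Suc.prems by simp
qed

lemma Ck_on_const: "Ck_on k (\<lambda>q. c) S"
  by (induction k arbitrary: c) simp_all

lemma Ck_on_add:
  assumes "open S" "Ck_on k F S" "Ck_on k G S"
  shows "Ck_on k (\<lambda>q. F q + G q) S"
  using assms(2,3)
proof (induction k arbitrary: F G)
  case 0
  then show ?case by (simp add: continuous_on_add)
next
  case (Suc k)
  have D: "((\<lambda>q. F q + G q) has_derivative
      (\<lambda>v. frechet_derivative F (at q) v + frechet_derivative G (at q) v)) (at q)" if "q \<in> S" for q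
    using Suc.prems that by (intro has_derivative_add) (simp_all add: frechet_derivative_works[symmetric])
  have "Ck_on k (\<lambda>q. frechet_derivative F (at q) v + frechet_derivative G (at q) v) S" for v
    using Suc by simp
  then have "Ck_on k (\<lambda>q. frechet_derivative (\<lambda>q. F q + G q) (at q) v) S" for v
    by (rule Ck_on_cong[OF assms(1), rotated]) (simp flip: frechet_derivative_at[OF D])
  then show ?case using D by (auto simp: differentiable_def)
qed

lemma Ck_on_sum:
  assumes "open S" "finite I" "\<And>i. i \<in> I \<Longrightarrow> Ck_on k (F i) S"
  shows "Ck_on k (\<lambda>q. \<Sum>i\<in>I. F i q) S"
  using assms(2,3) by (induction I rule: finite_induct) (simp_all add: Ck_on_const Ck_on_add[OF assms(1)])

lemma Ck_on_bilinear:
  assumes h: "bounded_bilinear h" and S: "open S" and "Ck_on k F S" "Ck_on k G S"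
  shows "Ck_on k (\<lambda>q. h (F q) (G q)) S"
  using assms(3,4)
proof (induction k arbitrary: F G)
  case 0
  then show ?case using bounded_bilinear.continuous_on[OF h] by simp
next
  case (Suc k)
  have D: "((\<lambda>q. h (F q) (G q)) has_derivative
      (\<lambda>v. h (F q) (frechet_derivative G (at q) v) + h (frechet_derivative F (at q) v) (G q))) (at q)"
    if "q \<in> S" for q
    using Suc.prems that
    by (intro bounded_bilinear.FDERIV[OF h]) (simp_all add: frechet_derivative_works[symmetric])
  have "Ck_on k (\<lambda>q. h (F q) (frechet_derivative G (at q) v) + h (frechet_derivative F (at q) v) (G q)) S" for v
    using Suc.prems Ck_on_Suc_imp[OF Suc.prems(1)] Ck_on_Suc_imp[OF Suc.prems(2)]
    by (intro Ck_on_add S Suc.IH) simp_all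
  then have "Ck_on k (\<lambda>q. frechet_derivative (\<lambda>q. h (F q) (G q)) (at q) v) S" for v
    by (rule Ck_on_cong[OF S, rotated]) (simp flip: frechet_derivative_at[OF D])
  then show ?case using D by (auto simp: differentiable_def)
qed

lemma Ck_on_has_derivative:
  assumes "Ck_on (Suc k) F S" "q \<in> S"
  shows "(F has_derivative frechet_derivative F (at q)) (at q)"
  using assms by (simp add: frechet_derivative_works[symmetric])

section \<open>Symmetry of second derivatives\<close>

text \<open>The mean value theorem is applied twice: to the difference of \<phi> along two parallel
  sides of the parallelogram, as a function of \<open>a\<close>, then to \<open>\<phi>'\<close> in
  direction \<open>u\<close>, as a function of \<open>b\<close>.\<close>

lemma second_difference_mvt:
  fixes \<phi> :: "'a::real_normed_vector \<Rightarrow> real"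
  assumes t: "0 < t"
    and S: "\<And>a b. a \<in> {0..t} \<Longrightarrow> b \<in> {0..t} \<Longrightarrow> q + a *\<^sub>R u + b *\<^sub>R v \<in> S"
    and D1: "\<And>r. r \<in> S \<Longrightarrow> (\<phi> has_derivative \<phi>' r) (at r)"
    and D2: "\<And>r. r \<in> S \<Longrightarrow> ((\<lambda>r. \<phi>' r u) has_derivative \<phi>'' r) (at r)"
  obtains a b where "a \<in> {0..t}" "b \<in> {0..t}"
    "\<phi> (q + t *\<^sub>R u + t *\<^sub>R v) - \<phi> (q + t *\<^sub>R u) - \<phi> (q + t *\<^sub>R v) + \<phi> q
      = t * (t * \<phi>'' (q + a *\<^sub>R u + b *\<^sub>R v) v)"
proof -
  have lin: "\<phi>' r (c *\<^sub>R w) = c * \<phi>' r w" if "r \<in> S" for r c w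
    using has_derivative_linear[OF D1[OF that]] by (simp add: linear_cmul)
  have lin2: "\<phi>'' r (c *\<^sub>R w) = c * \<phi>'' r w" if "r \<in> S" for r c w
    using has_derivative_linear[OF D2[OF that]] by (simp add: linear_cmul)
  have D_a: "((\<lambda>a. \<phi> (q + a *\<^sub>R u + t *\<^sub>R v) - \<phi> (q + a *\<^sub>R u)) has_real_derivative
      \<phi>' (q + a *\<^sub>R u + t *\<^sub>R v) u - \<phi>' (q + a *\<^sub>R u) u) (at a)" if "0 \<le> a" "a \<le> t" for a
  proof -
    have 1: "q + a *\<^sub>R u + t *\<^sub>R v \<in> S" "q + a *\<^sub>R u \<in> S"
      using S[of a t] S[of a 0] that t by auto
    have "((\<lambda>a. \<phi> (q + a *\<^sub>R u + t *\<^sub>R v) - \<phi> (q + a *\<^sub>R u)) has_derivative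
      (\<lambda>c. \<phi>' (q + a *\<^sub>R u + t *\<^sub>R v) (c *\<^sub>R u) - \<phi>' (q + a *\<^sub>R u) (c *\<^sub>R u))) (at a)"
      by (rule has_derivative_diff; rule has_derivative_compose[OF _ D1])
         (use 1 in \<open>auto intro!: derivative_eq_intros\<close>)
    then show ?thesis
      by (rule has_derivative_imp_has_field_derivative) (simp add: lin 1 right_diff_distrib)
  qed
  obtain a where a: "0 < a" "a < t"
    "(\<phi> (q + t *\<^sub>R u + t *\<^sub>R v) - \<phi> (q + t *\<^sub>R u)) - (\<phi> (q + 0 *\<^sub>R u + t *\<^sub>R v) - \<phi> (q + 0 *\<^sub>R u))
      = (t - 0) * (\<phi>' (q + a *\<^sub>R u + t *\<^sub>R v) u - \<phi>' (q + a *\<^sub>R u) u)"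
    using MVT2[OF t D_a] by blast
  have D_b: "((\<lambda>b. \<phi>' (q + a *\<^sub>R u + b *\<^sub>R v) u) has_real_derivative
      \<phi>'' (q + a *\<^sub>R u + b *\<^sub>R v) v) (at b)" if "0 \<le> b" "b \<le> t" for b
  proof -
    have 1: "q + a *\<^sub>R u + b *\<^sub>R v \<in> S"
      using S[of a b] that a by auto
    have "((\<lambda>b. \<phi>' (q + a *\<^sub>R u + b *\<^sub>R v) u) has_derivative
      (\<lambda>c. \<phi>'' (q + a *\<^sub>R u + b *\<^sub>R v) (c *\<^sub>R v))) (at b)"
      by (rule has_derivative_compose[OF _ D2])
         (use 1 in \<open>auto intro!: derivative_eq_intros\<close>)
    then show ?thesis
      by (rule has_derivative_imp_has_field_derivative) (simp add: lin2 1)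
  qed
  obtain b where b: "0 < b" "b < t"
    "\<phi>' (q + a *\<^sub>R u + t *\<^sub>R v) u - \<phi>' (q + a *\<^sub>R u + 0 *\<^sub>R v) u
      = (t - 0) * \<phi>'' (q + a *\<^sub>R u + b *\<^sub>R v) v"
    using MVT2[OF t D_b] by blast
  show ?thesis
    by (rule that[of a b]) (use a b in auto)
qed

text \<open>The second difference is symmetric in \<open>u\<close> and \<open>v\<close>, so the two
  orders of differentiation agree at points arbitrarily close to \<open>q\<close>; continuity
  carries this to \<open>q\<close>.\<close>

lemma second_derivative_symmetric_real:
  fixes \<phi> :: "'a::real_normed_vector \<Rightarrow> real"
  assumes "open S" "q \<in> S"
    and D: "\<And>r. r \<in> S \<Longrightarrow> (\<phi> has_derivative \<phi>' r) (at r)"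
    and D2: "\<And>w r. r \<in> S \<Longrightarrow> ((\<lambda>r. \<phi>' r w) has_derivative \<phi>'' w r) (at r)"
    and cont: "\<And>w z. continuous_on S (\<lambda>r. \<phi>'' w r z)"
  shows "\<phi>'' u q v = \<phi>'' v q u"
proof (rule ccontr)
  assume ne: "\<phi>'' u q v \<noteq> \<phi>'' v q u"
  \<comment> \<open>Half the gap: two equal numbers cannot each be strictly within \<open>e\<close>
    of the opposite ends.\<close>
  define e where "e = \<bar>\<phi>'' u q v - \<phi>'' v q u\<bar> / 2"
  have e: "e > 0" using ne by (simp add: e_def)
  have "isCont (\<lambda>r. \<phi>'' u r v) q" "isCont (\<lambda>r. \<phi>'' v r u) q"
    using cont assms(1,2) continuous_on_eq_continuous_at by blast+
  then have "\<exists>d>0. \<forall>r. dist r q < d \<longrightarrow> dist (\<phi>'' u r v) (\<phi>'' u q v) < e"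
    and "\<exists>d>0. \<forall>r. dist r q < d \<longrightarrow> dist (\<phi>'' v r u) (\<phi>'' v q u) < e"
    using e unfolding continuous_at_eps_delta by blast+
  then obtain d1 d2 where d: "d1 > 0" "d2 > 0"
    "\<And>r. dist r q < d1 \<Longrightarrow> dist (\<phi>'' u r v) (\<phi>'' u q v) < e"
    "\<And>r. dist r q < d2 \<Longrightarrow> dist (\<phi>'' v r u) (\<phi>'' v q u) < e"
    by blast
  obtain d3 where d3: "d3 > 0" "ball q d3 \<subseteq> S"
    using assms(1,2) openE by blast
  define d where "d = min d3 (min d1 d2)"
  have d0: "d > 0" using d(1,2) d3(1) by (simp add: d_def)
  \<comment> \<open>This keeps the parallelogram with sides \<open>t u\<close> and
    \<open>t v\<close> at distance less than \<open>d\<close> from \<open>q\<close>; the summand 1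
    makes the denominator positive and the estimate strict.\<close>
  define t where "t = d / (norm u + norm v + 1)"
  have pos: "norm u + norm v + 1 > 0"
    by (simp add: add_nonneg_pos)
  then have t: "t > 0" using d0 by (simp add: t_def)
  have near: "dist (q + a *\<^sub>R u + b *\<^sub>R v) q < d" if "a \<in> {0..t}" "b \<in> {0..t}" for a b
  proof -
    have "norm (a *\<^sub>R u + b *\<^sub>R v) \<le> a * norm u + b * norm v"
      using that norm_triangle_ineq[of "a *\<^sub>R u" "b *\<^sub>R v"] by simp
    also have "\<dots> \<le> t * norm u + t * norm v"
      using that by (intro add_mono mult_right_mono) auto
    also have "\<dots> < t * (norm u + norm v + 1)"
      using t by (simp add: algebra_simps)
    also have "\<dots> = d" using pos by (simp add: t_def)
    finally show ?thesis by (simp add: dist_norm add.assoc)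
  qed
  have inS: "r \<in> S" if "dist r q < d" for r
    using that d3(2) by (auto simp: d_def dist_commute)
  obtain a b where ab: "a \<in> {0..t}" "b \<in> {0..t}"
    "\<phi> (q + t *\<^sub>R u + t *\<^sub>R v) - \<phi> (q + t *\<^sub>R u) - \<phi> (q + t *\<^sub>R v) + \<phi> q
      = t * (t * \<phi>'' u (q + a *\<^sub>R u + b *\<^sub>R v) v)"
    by (rule second_difference_mvt[OF t inS[OF near] D D2]) auto
  obtain a' b' where ab': "a' \<in> {0..t}" "b' \<in> {0..t}"
    "\<phi> (q + t *\<^sub>R v + t *\<^sub>R u) - \<phi> (q + t *\<^sub>R v) - \<phi> (q + t *\<^sub>R u) + \<phi> q
      = t * (t * \<phi>'' v (q + a' *\<^sub>R v + b' *\<^sub>R u) u)"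
  proof (rule second_difference_mvt[OF t _ D D2, of q v u S])
    show "q + a *\<^sub>R v + b *\<^sub>R u \<in> S" if "a \<in> {0..t}" "b \<in> {0..t}" for a b
      using inS[OF near[OF that(2,1)]] by (simp add: add_ac)
  qed auto
  have "t * (t * \<phi>'' u (q + a *\<^sub>R u + b *\<^sub>R v) v) = t * (t * \<phi>'' v (q + a' *\<^sub>R v + b' *\<^sub>R u) u)"
    unfolding ab(3)[symmetric] ab'(3)[symmetric] by (simp add: algebra_simps)
  then have eq: "\<phi>'' u (q + a *\<^sub>R u + b *\<^sub>R v) v = \<phi>'' v (q + b' *\<^sub>R u + a' *\<^sub>R v) u"
    using t by (simp add: add_ac)
  have "dist (\<phi>'' u (q + a *\<^sub>R u + b *\<^sub>R v) v) (\<phi>'' u q v) < e"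
    by (rule d(3)) (use near[OF ab(1,2)] in \<open>simp add: d_def\<close>)
  moreover have "dist (\<phi>'' v (q + b' *\<^sub>R u + a' *\<^sub>R v) u) (\<phi>'' v q u) < e"
    by (rule d(4)) (use near[OF ab'(2,1)] in \<open>simp add: d_def\<close>)
  ultimately show False
    unfolding eq e_def dist_real_def by argo
qed

lemma Ck_on_second_derivative_symmetric:
  fixes F :: "'e::euclidean_space \<Rightarrow> 'b::euclidean_space"
  assumes S: "open S" "q \<in> S" and F: "Ck_on 2 F S"
  shows "frechet_derivative (\<lambda>r. frechet_derivative F (at r) u) (at q) v
    = frechet_derivative (\<lambda>r. frechet_derivative F (at r) v) (at q) u"
proof (rule euclidean_eqI)
  fix b :: 'b
  have F2: "Ck_on (Suc (Suc 0)) F S" using F by (simp only: numeral_2_eq_2)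
  have F1: "Ck_on (Suc 0) (\<lambda>r. frechet_derivative F (at r) w) S" for w
    using F2 unfolding Ck_on.simps(2)[of "Suc 0"] by blast
  show "frechet_derivative (\<lambda>r. frechet_derivative F (at r) u) (at q) v \<bullet> b
    = frechet_derivative (\<lambda>r. frechet_derivative F (at r) v) (at q) u \<bullet> b"
  proof (rule second_derivative_symmetric_real[OF S, where \<phi> = "\<lambda>r. F r \<bullet> b"
        and \<phi>' = "\<lambda>r w. frechet_derivative F (at r) w \<bullet> b"
        and \<phi>'' = "\<lambda>w r z. frechet_derivative (\<lambda>r. frechet_derivative F (at r) w) (at r) z \<bullet> b"])
    show "continuous_on S (\<lambda>r. frechet_derivative (\<lambda>r. frechet_derivative F (at r) w) (at r) z \<bullet> b)"
      for w z using F1 by (auto intro!: continuous_intros)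
  qed (auto intro!: has_derivative_inner_left Ck_on_has_derivative[OF F2] Ck_on_has_derivative[OF F1])
qed

section \<open>The second fundamental form in a chart\<close>

text \<open>Differentiate both sides of \<open>eq\<close> once more and antisymmetrize: the mixed second derivatives cancel.\<close>
lemma commutator_of_derivatives:
  fixes X Y X' Y' :: "'e::euclidean_space \<Rightarrow> 'b::euclidean_space"
  assumes S: "open S" "q \<in> S"
    and Ck: "Ck_on 2 X S" "Ck_on 2 Y S" "Ck_on 2 X' S" "Ck_on 2 Y' S"
    and eq: "\<And>r v. r \<in> S \<Longrightarrow>
      frechet_derivative X (at r) v \<bullet> Y r = frechet_derivative X' (at r) v \<bullet> Y' r"
  shows "frechet_derivative X (at q) y \<bullet> frechet_derivative Y (at q) x
      - frechet_derivative X (at q) x \<bullet> frechet_derivative Y (at q) y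
    = frechet_derivative X' (at q) y \<bullet> frechet_derivative Y' (at q) x
      - frechet_derivative X' (at q) x \<bullet> frechet_derivative Y' (at q) y"
proof -
  have Ck1: "(Z has_derivative frechet_derivative Z (at q)) (at q)"
    if "Ck_on 2 Z S" for Z :: "'e \<Rightarrow> 'b"
    using that S(2) by (intro Ck_on_has_derivative[of 1]) (simp_all only: Suc_1)
  have Ck2: "((\<lambda>r. frechet_derivative Z (at r) v) has_derivative
      frechet_derivative (\<lambda>r. frechet_derivative Z (at r) v) (at q)) (at q)"
    if "Ck_on 2 Z S" for Z :: "'e \<Rightarrow> 'b" and v
  proof (rule Ck_on_has_derivative[OF _ S(2)])
    show "Ck_on (Suc 0) (\<lambda>r. frechet_derivative Z (at r) v) S"
      using that unfolding numeral_2_eq_2 Ck_on.simps(2)[of "Suc 0"] by blast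
  qed
  have D: "((\<lambda>r. frechet_derivative Z (at r) v \<bullet> W r) has_derivative
      (\<lambda>u. frechet_derivative Z (at q) v \<bullet> frechet_derivative W (at q) u
         + frechet_derivative (\<lambda>r. frechet_derivative Z (at r) v) (at q) u \<bullet> W q)) (at q)"
    if "Ck_on 2 Z S" "Ck_on 2 W S" for Z W :: "'e \<Rightarrow> 'b" and v
    by (rule has_derivative_inner[OF Ck2[OF that(1)] Ck1[OF that(2)]])
  have "(\<lambda>u. frechet_derivative X (at q) v \<bullet> frechet_derivative Y (at q) u
      + frechet_derivative (\<lambda>r. frechet_derivative X (at r) v) (at q) u \<bullet> Y q)
    = (\<lambda>u. frechet_derivative X' (at q) v \<bullet> frechet_derivative Y' (at q) u
      + frechet_derivative (\<lambda>r. frechet_derivative X' (at r) v) (at q) u \<bullet> Y' q)" for v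
    using has_derivative_transform_within_open[OF D[OF Ck(1,2), of v] S eq] D[OF Ck(3,4), of v]
    by (rule has_derivative_unique)
  from fun_cong[OF this[of y], of x] fun_cong[OF this[of x], of y]
  show ?thesis
    using Ck_on_second_derivative_symmetric[OF S Ck(1), of x y]
      Ck_on_second_derivative_symmetric[OF S Ck(3), of x y]
      eq[OF S(2)] by simp
qed

section \<open>Gauss formula and flatness in coordinates\<close>

text \<open>One chart in coordinates, with \<open>F\<close> the immersion. \<open>parallel\<close>
  is \<nabla>J = 0 on the constant field \<open>v\<close>, whose ordinary derivative
  vanishes.\<close>

locale kaehler_patch =
  fixes S :: "'e::euclidean_space set"
    and F :: "'e \<Rightarrow> 'b::euclidean_space"
    and G :: "'e local_metric"
    and J :: "'e local_endo"
  assumes open_S: "open S"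
    and smooth_F: "smooth_on S F"
    and smooth_J: "smooth_on S (\<lambda>q. J q v)"
    and inj: "q \<in> S \<Longrightarrow> inj (frechet_derivative F (at q))"
    and metric: "q \<in> S \<Longrightarrow> frechet_derivative F (at q) u \<bullet> frechet_derivative F (at q) v = G q u v"
    and linear_J: "q \<in> S \<Longrightarrow> linear (J q)"
    and J_J: "q \<in> S \<Longrightarrow> J q (J q v) = - v"
    and G_J: "q \<in> S \<Longrightarrow> G q (J q u) (J q v) = G q u v"
    and parallel: "q \<in> S \<Longrightarrow>
      frechet_derivative (\<lambda>r. J r v) (at q) u + christoffel G q u (J q v) = J q (christoffel G q u v)"
begin

definition D :: "'e \<Rightarrow> 'e \<Rightarrow> 'b" where
  "D q = frechet_derivative F (at q)"

definition D2 :: "'e \<Rightarrow> 'e \<Rightarrow> 'e \<Rightarrow> 'b" where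
  "D2 q u v = frechet_derivative (\<lambda>r. D r v) (at q) u"

definition sff :: "'e \<Rightarrow> 'e \<Rightarrow> 'e \<Rightarrow> 'b" where
  "sff q u v = orth_proj (orthogonal_comp (range (D q))) (D2 q u v)"

definition E :: "'e \<Rightarrow> 'e \<Rightarrow> 'b" where
  "E v r = D r (J r v)"

lemma Ck_D: "Ck_on k (\<lambda>r. D r v) S"
proof -
  have "Ck_on (Suc k) F S" using smooth_F by (simp add: smooth_on_def)
  then show ?thesis by (simp add: D_def)
qed

lemma D_metric: "q \<in> S \<Longrightarrow> D q u \<bullet> D q v = G q u v"
  by (simp add: D_def metric)

lemma D_inj: "q \<in> S \<Longrightarrow> D q u = D q v \<longleftrightarrow> u = v"
  using inj by (simp add: D_def inj_eq)

lemma linear_D: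
  assumes "q \<in> S"
  shows "linear (D q)"
proof -
  have "Ck_on (Suc 0) F S" using smooth_F by (simp only: smooth_on_def)
  then show ?thesis
    unfolding D_def using assms by (intro linear_frechet_derivative) simp
qed

lemma has_derivative_D:
  assumes "q \<in> S"
  shows "((\<lambda>r. D r v) has_derivative (\<lambda>u. D2 q u v)) (at q)"
  using Ck_on_has_derivative[OF Ck_D assms] unfolding D2_def .

lemma D2_sym: "q \<in> S \<Longrightarrow> D2 q u v = D2 q v u"
  using Ck_on_second_derivative_symmetric[OF open_S, of q F v u] smooth_F
  by (simp add: D2_def D_def smooth_on_def)

lemma linear_D2:
  assumes "q \<in> S"
  shows "linear (\<lambda>u. D2 q u v)" "linear (D2 q v)"
proof -
  show "linear (\<lambda>u. D2 q u v)" for v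
    using has_derivative_D[OF assms] by (rule has_derivative_linear)
  then show "linear (D2 q v)"
    using D2_sym[OF assms, of v] by (metis (no_types, lifting) ext)
qed

lemma derivative_metric:
  assumes "q \<in> S"
  shows "frechet_derivative (\<lambda>r. G r v w) (at q) u = D q v \<bullet> D2 q u w + D2 q u v \<bullet> D q w"
proof -
  have "((\<lambda>r. D r v \<bullet> D r w) has_derivative (\<lambda>u. D q v \<bullet> D2 q u w + D2 q u v \<bullet> D q w)) (at q)"
    by (rule has_derivative_inner[OF has_derivative_D has_derivative_D]) (fact assms)+
  then have "((\<lambda>r. G r v w) has_derivative (\<lambda>u. D q v \<bullet> D2 q u w + D2 q u v \<bullet> D q w)) (at q)"
    by (rule has_derivative_transform_within_open[OF _ open_S assms]) (rule D_metric)
  then show ?thesis by (simp flip: frechet_derivative_at)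
qed

text \<open>The metric is induced by \<open>F\<close>, so the Koszul formula determines the
  tangential part of the second derivative; injectivity of \<open>D q\<close> makes its coordinate
  vector the unique solution required by \<open>THE\<close>.\<close>

lemma christoffel:
  assumes q: "q \<in> S"
  shows "D q (christoffel G q u v) \<bullet> D q w = D2 q u v \<bullet> D q w"
proof -
  have R: "subspace (range (D q))"
    using linear_D[OF q] by (simp add: linear_subspace_image)
  obtain z where z: "orth_proj (range (D q)) (D2 q u v) = D q z"
    using orth_proj_in[OF R] by blast
  have Dz: "D q z \<bullet> D q w = D2 q u v \<bullet> D q w" for w
    using orth_proj_orthogonal[OF R, of "D q w" "D2 q u v"] z by (simp add: inner_diff_left)
  \<comment> \<open>Each derivative of the metric contributes two terms; by symmetry of
    \<open>D2\<close>, four of the six cancel in pairs.\<close>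
  have koszul: "frechet_derivative (\<lambda>r. G r v w) (at q) u
     + frechet_derivative (\<lambda>r. G r u w) (at q) v
     - frechet_derivative (\<lambda>r. G r u v) (at q) w = 2 * (D2 q u v \<bullet> D q w)" for w
    unfolding derivative_metric[OF q]
    by (simp add: D2_sym[OF q, of w] D2_sym[OF q, of v u] inner_commute)
  have "christoffel G q u v = z"
    unfolding christoffel_def koszul
  proof (rule the_equality)
    show "\<forall>w. 2 * G q z w = 2 * (D2 q u v \<bullet> D q w)"
      using Dz q by (simp flip: D_metric)
    fix z' assume "\<forall>w. 2 * G q z' w = 2 * (D2 q u v \<bullet> D q w)"
    then have z': "D q z' \<bullet> D q w = D q z \<bullet> D q w" for w
      using Dz q by (simp add: D_metric)
    have "D q (z' - z) \<bullet> D q (z' - z) = 0"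
      using z'[of "z' - z"] by (simp add: linear_diff[OF linear_D[OF q]] inner_diff_left)
    then show "z' = z"
      using q by (simp add: linear_diff[OF linear_D[OF q]] D_inj)
  qed
  then show ?thesis using Dz by simp
qed

text \<open>The Gauss formula: by \<open>christoffel\<close>, the subtracted vector is the
  tangential part.\<close>

lemma sff_eq:
  assumes q: "q \<in> S"
  shows "sff q u v = D2 q u v - D q (christoffel G q u v)"
  unfolding sff_def
proof (rule orth_proj_unique)
  show "D2 q u v - D q (christoffel G q u v) \<in> orthogonal_comp (range (D q))"
    using christoffel[OF q, of u v]
    by (auto simp: orthogonal_comp_def orthogonal_def inner_diff_right inner_commute)
next
  show "(D2 q u v - (D2 q u v - D q (christoffel G q u v))) \<bullet> w = 0"
    if "w \<in> orthogonal_comp (range (D q))" for w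
    using that by (auto simp: orthogonal_comp_def orthogonal_def)
qed (rule subspace_orthogonal_comp)

lemma D_sff: "q \<in> S \<Longrightarrow> sff q u v \<bullet> D q w = 0"
  using christoffel[of q u v w] by (simp add: sff_eq inner_diff_left)

text \<open>In \<open>E\<close> both the linear map and its argument vary with \<open>r\<close>; a
  fixed basis turns it into a sum of products open to the product rule.\<close>

lemma E_expand: "r \<in> S \<Longrightarrow> E v r = (\<Sum>b\<in>Basis. (J r v \<bullet> b) *\<^sub>R D r b)"
  using arg_cong[OF euclidean_representation[of "J r v"], of "D r"]
  by (simp add: E_def linear_sum[OF linear_D] linear_cmul[OF linear_D])

lemma Ck_J: "Ck_on k (\<lambda>r. J r v \<bullet> b) S"
  using smooth_J
  by (intro Ck_on_bilinear[OF bounded_bilinear_inner open_S] Ck_on_const) (simp add: smooth_on_def)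

lemma Ck_E: "Ck_on k (E v) S"
proof (rule Ck_on_cong[OF open_S])
  show "Ck_on k (\<lambda>r. \<Sum>b\<in>Basis. (J r v \<bullet> b) *\<^sub>R D r b) S"
    by (intro Ck_on_sum Ck_on_bilinear[OF bounded_bilinear_scaleR] open_S Ck_J Ck_D) simp
qed (simp add: E_expand)

text \<open>The product rule gives \<open>D2 q u (J q v)\<close> plus the image of the derivative of
  \<open>J\<close>. After the Gauss formula, \<open>parallel\<close> merges the two tangential
  terms.\<close>

lemma derivative_E:
  assumes q: "q \<in> S"
  shows "frechet_derivative (E v) (at q) u = D q (J q (christoffel G q u v)) + sff q u (J q v)"
proof -
  let ?J' = "frechet_derivative (\<lambda>r. J r v) (at q)"
  have "Ck_on (Suc 0) (\<lambda>r. J r v) S" using smooth_J by (simp only: smooth_on_def)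
  then have J': "((\<lambda>r. J r v) has_derivative ?J') (at q)"
    using q by (rule Ck_on_has_derivative)
  have "((\<lambda>r. \<Sum>b\<in>Basis. (J r v \<bullet> b) *\<^sub>R D r b) has_derivative
      (\<lambda>u. \<Sum>b\<in>Basis. (J q v \<bullet> b) *\<^sub>R D2 q u b + (?J' u \<bullet> b) *\<^sub>R D q b)) (at q)"
    by (intro has_derivative_sum has_derivative_scaleR has_derivative_inner_left J' has_derivative_D q)
  then have "(E v has_derivative
      (\<lambda>u. \<Sum>b\<in>Basis. (J q v \<bullet> b) *\<^sub>R D2 q u b + (?J' u \<bullet> b) *\<^sub>R D q b)) (at q)"
    by (rule has_derivative_transform_within_open[OF _ open_S q]) (simp add: E_expand)
  then have "frechet_derivative (E v) (at q) u
      = (\<Sum>b\<in>Basis. (J q v \<bullet> b) *\<^sub>R D2 q u b + (?J' u \<bullet> b) *\<^sub>R D q b)"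
    by (simp flip: frechet_derivative_at)
  also have "\<dots> = D2 q u (J q v) + D q (?J' u)"
    using arg_cong[OF euclidean_representation[of "J q v"], of "D2 q u"]
      arg_cong[OF euclidean_representation[of "?J' u"], of "D q"] q
    by (simp add: linear_sum[OF linear_D] linear_cmul[OF linear_D]
        linear_sum[OF linear_D2(2)] linear_cmul[OF linear_D2(2)] sum.distrib)
  also have "D2 q u (J q v) = D q (christoffel G q u (J q v)) + sff q u (J q v)"
    by (simp add: sff_eq q)
  also have "\<dots> + D q (?J' u) = D q (?J' u + christoffel G q u (J q v)) + sff q u (J q v)"
    by (simp add: linear_add[OF linear_D[OF q]])
  finally show ?thesis unfolding parallel[OF q] .
qed

text \<open>
  The vector fields \<open>D _ y\<close> and \<open>E y\<close> represent \<open>y\<close> and \<open>J y\<close> along the immersion. As \<open>J\<close> is parallel and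
  orthogonal, \<open>\<langle>\<partial>\<^sub>v D y, D w\<rangle> = \<langle>\<partial>\<^sub>v E y, E w\<rangle>\<close>, and differentiating this gives the identity
  without mentioning the curvature tensor.
\<close>
lemma sff_flat:
  assumes q: "q \<in> S"
  shows "sff q x w \<bullet> sff q z y - sff q x (J q w) \<bullet> sff q z (J q y)
    = sff q x y \<bullet> sff q z w - sff q x (J q y) \<bullet> sff q z (J q w)"
proof -
  have D2: "frechet_derivative (\<lambda>r. D r v) (at r) u = D r (christoffel G r u v) + sff r u v"
    if "r \<in> S" for r u v
    by (simp add: sff_eq[OF that] flip: D2_def)
  have "frechet_derivative (\<lambda>r. D r y) (at q) z \<bullet> frechet_derivative (\<lambda>r. D r w) (at q) x
      - frechet_derivative (\<lambda>r. D r y) (at q) x \<bullet> frechet_derivative (\<lambda>r. D r w) (at q) z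
    = frechet_derivative (E y) (at q) z \<bullet> frechet_derivative (E w) (at q) x
      - frechet_derivative (E y) (at q) x \<bullet> frechet_derivative (E w) (at q) z"
  proof (rule commutator_of_derivatives[OF open_S q Ck_D Ck_D Ck_E Ck_E])
    show "frechet_derivative (\<lambda>r. D r y) (at r) v \<bullet> D r w = frechet_derivative (E y) (at r) v \<bullet> E w r"
      if "r \<in> S" for r v
      using that by (simp add: D2 derivative_E E_def D_sff D_metric G_J inner_add_left)
  qed
  moreover have "D q w \<bullet> sff q u v = 0" for u v w
    using D_sff[OF q] by (simp add: inner_commute)
  \<comment> \<open>The tangential products on the two sides agree by \<open>G_J\<close>, and
    tangential-normal products vanish, so only normal products remain.\<close>
  ultimately show ?thesis
    using q by (simp add: D2 derivative_E D_sff D_metric G_J inner_simps)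
       (simp add: inner_commute)
qed

lemma kaehler_flat_form_sff:
  assumes q: "q \<in> S"
  shows "kaehler_flat_form (sff q) (J q)"
proof (rule kaehler_flat_form.intro)
  have proj: "linear (orth_proj (orthogonal_comp (range (D q))))"
    by (rule linear_orth_proj[OF subspace_orthogonal_comp])
  show "bilinear (sff q)"
    unfolding bilinear_def sff_def
    using linear_compose[OF linear_D2(1)[OF q] proj] linear_compose[OF linear_D2(2)[OF q] proj]
    by (simp add: comp_def)
  show "sff q x y = sff q y x" for x y
    by (simp add: sff_def D2_sym[OF q, of x])
qed (rule linear_J[OF q] J_J[OF q] sff_flat[OF q])+

end

section \<open>Minimality\<close>

lemma kaehler_patch_chart:
  assumes A: "kaehler_manifold A g J" and f: "isometric_immersion A g f" and c: "c \<in> A"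
  shows "kaehler_patch (chart_image c) (in_chart f c) (g c) (J c)"
proof -
  have chart: "is_chart c" and J: "almost_complex_structure A J"
    and kaehler: "kaehler_structure A g J"
    using A c by (auto simp: kaehler_manifold_def smooth_atlas_def kaehler_structure_def)
  show ?thesis
  proof (rule kaehler_patch.intro)
    show "open (chart_image c)" using chart by (simp add: is_chart_def)
    show "smooth_on (chart_image c) (in_chart f c)"
      using f c by (simp add: isometric_immersion_def)
    show "smooth_on (chart_image c) (\<lambda>q. J c q v)" for v
      using J c by (simp add: almost_complex_structure_def)
    fix q assume q: "q \<in> chart_image c"
    then obtain x where x: "x \<in> chart_dom c" "q = chart_map c x"
      by (auto simp: chart_image_def)
    show "inj (frechet_derivative (in_chart f c) (at q))"
      and "frechet_derivative (in_chart f c) (at q) u \<bullet> frechet_derivative (in_chart f c) (at q) v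
        = g c q u v" for u v
      using f c x by (auto simp: isometric_immersion_def differential_def)
    show "linear (J c q)" "J c q (J c q v) = - v" for v
      using J c q by (auto simp: almost_complex_structure_def)
    show "g c q (J c q u) (J c q v) = g c q u v" for u v
      using kaehler c q by (auto simp: kaehler_structure_def)
    \<comment> \<open>Testing parallelism of \<open>J\<close> on constant coordinate fields reduces
      \<open>cov_deriv\<close> of \<open>v\<close> to \<open>christoffel\<close>.\<close>
    have "smooth_on (chart_image c) (\<lambda>r. v)" for v :: 'b
      by (simp add: smooth_on_def Ck_on_const)
    then have "cov_deriv (g c) q u (\<lambda>r. J c r v) = J c q (cov_deriv (g c) q u (\<lambda>r. v))" for u v
      using kaehler c q by (auto simp: kaehler_structure_def)
    then show "frechet_derivative (\<lambda>r. J c r v) (at q) u + christoffel (g c) q u (J c q v)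
        = J c q (christoffel (g c) q u v)" for u v
      by (simp add: cov_deriv_def)
  qed
qed

text \<open>\<open>Max\<close> bounds its elements only on a finite set; here all elements are
  dimensions, at most \<open>DIM('e)\<close>.\<close>

lemma dim_le_complex_nullity:
  fixes J :: "('a, 'e::euclidean_space) chart \<Rightarrow> 'e local_endo"
  assumes "subspace U" "U \<subseteq> normal_space f c x" "dim U = s"
  shows "dim (nullity_space f c x U \<inter> J c (chart_map c x) ` nullity_space f c x U)
    \<le> complex_nullity J f s c x"
  unfolding complex_nullity_def
proof (rule Max_ge)
  show "finite {dim (nullity_space f c x U \<inter> J c (chart_map c x) ` nullity_space f c x U) | U.
      subspace U \<and> U \<subseteq> normal_space f c x \<and> dim U = s}"
    by (rule finite_subset[of _ "{..DIM('e)}"]) (auto intro: dim_subset_UNIV)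
qed (use assms in blast)

theorem theorem1:
  fixes A :: "('a::{t2_space, second_countable_topology}, 'e::euclidean_space) chart set"
    and g :: "('a, 'e) chart \<Rightarrow> 'e local_metric"
    and J :: "('a, 'e) chart \<Rightarrow> 'e local_endo"
    and f :: "'a \<Rightarrow> 'b::euclidean_space"
    and n p :: nat
  assumes "n \<ge> 2" and "p \<ge> 1"
    and "DIM('e) = 2 * n" and "DIM('b) = 2 * n + p"
    and "connected (UNIV :: 'a set)"
    and "kaehler_manifold A g J"
    and "isometric_immersion A g f"
    and "substantial f"
    and "\<And>x c s. c \<in> A \<Longrightarrow> x \<in> chart_dom c \<Longrightarrow> 1 \<le> s \<Longrightarrow> s \<le> p \<Longrightarrow>
           int (complex_nullity J f s c x) < 2 * (int n - int s)"
  shows "minimal_immersion A g f"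
  unfolding minimal_immersion_def
proof (intro conjI ballI allI impI)
  show "isometric_immersion A g f" by fact
  fix c x B
  assume c: "c \<in> A" and x: "x \<in> chart_dom c" and B: "orthonormal_basis (g c (chart_map c x)) B"
  define q where "q = chart_map c x"
  interpret kaehler_patch "chart_image c" "in_chart f c" "g c" "J c"
    using assms(6,7) c by (rule kaehler_patch_chart)
  have q: "q \<in> chart_image c" using x by (simp add: q_def chart_image_def)
  interpret kaehler_flat_form "sff q" "J c q"
    using q by (rule kaehler_flat_form_sff)
  have normal: "normal_space f c x = orthogonal_comp (range (D q))"
    by (simp add: normal_space_def differential_def D_def q_def)
  have \<alpha>: "second_fundamental_form f c x = sff q"
    by (simp add: fun_eq_iff second_fundamental_form_def sff_def normal D2_def)
       (simp add: D_def q_def)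
  \<comment> \<open>The normal space must have dimension exactly \<open>p\<close>, so that every
    \<open>U\<close> inside it falls in the range of \<open>s\<close> covered by the nullity
    assumption.\<close>
  have "dim (range (D q)) = DIM('e)"
    using dim_image_eq[OF linear_D[OF q], of UNIV] inj[OF q] by (simp add: D_def)
  moreover have "subspace (range (D q))"
    using linear_D[OF q] by (simp add: linear_subspace_image)
  moreover have "normal_space f c x = {y \<in> UNIV. \<forall>x\<in>range (D q). orthogonal x y}"
    by (auto simp: normal orthogonal_comp_def)
  ultimately have dim_normal: "dim (normal_space f c x) = p"
    using dim_subspace_orthogonal_to_vectors[of "range (D q)" UNIV] assms(3,4) by simp
  have "P u v = 0" for u v
  proof (rule P_eq_0_if_small_nullity)
    show W: "subspace (normal_space f c x)"
      by (simp add: normal subspace_orthogonal_comp)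
    show "sff q u v \<in> normal_space f c x" for u v
      using W unfolding sff_def normal by (rule orth_proj_in)
    fix U :: "'b set"
    assume U: "subspace U" "U \<subseteq> normal_space f c x" "dim U \<ge> 1"
    \<comment> \<open>The assumption is over the integers, where \<open>n - s\<close> does not
      truncate; here it takes the subtraction-free form over the naturals.\<close>
    have arith: "d + 2 * s < 2 * n" if "int N < 2 * (int n - int s)" "d \<le> N" for d s N :: nat
      using that by presburger
    have "dim U \<le> p" using dim_subset[OF U(2)] dim_normal by simp
    then have "int (complex_nullity J f (dim U) c x) < 2 * (int n - int (dim U))"
      using assms(9) c x U(3) by blast
    moreover have "dim (nullity_space f c x U \<inter> J c q ` nullity_space f c x U)
        \<le> complex_nullity J f (dim U) c x"
      unfolding q_def using U by (intro dim_le_complex_nullity) auto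
    ultimately show "dim ({u. \<forall>v. orth_proj U (sff q u v) = 0} \<inter> J c q ` {u. \<forall>v. orth_proj U (sff q u v) = 0})
        + 2 * dim U < DIM('e)"
      unfolding nullity_space_def \<alpha> assms(3) by (rule arith)
  qed
  moreover have "bilinear (g c q)" "g c q u v = g c q v u" for u v
    using assms(6) c q
    by (auto simp: kaehler_manifold_def kaehler_structure_def riemannian_metric_def)
  ultimately show "(\<Sum>b\<in>B. second_fundamental_form f c x b b) = 0"
    unfolding \<alpha> using trace_zero G_J[OF q] B by (simp add: q_def)
qed

end
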